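(* Let $(V,\langle\cdot,\cdot\rangle)$ be a pseudo-Euclidean vector space of dimension $n$ and let $(R,\nabla R,\nabla^{2)}R)$ be an algebraic two-jet on $V$. Then $(R,\nabla R,\nabla^{2)}R)$ is Einstein if and only if $\mathrm{ric}\in\mathbb{R}\,\langle\cdot,\cdot\rangle$, $\nabla\mathrm{ric}=0$, and the tensor $$\mathcal{R}^{2)}-\frac{1}{n+4}\,(\mathcal{R}*\mathcal{R})\odot\langle\cdot,\cdot\rangle\ \in\ \mathrm{Sym}^4V^*\otimes\mathrm{Sym}^2V^*$$ is totally trace-free.
   Context: Let $\{e_1,\dots,e_n\}$ be an orthonormal basis of $V$, $\epsilon_i=\langle e_i,e_i\rangle\in\{\pm1\}$. All traces are taken with respect to $\langle\cdot,\cdot\rangle$; a tensor is totally trace-free if all its contractions over pairs of slots vanish. $\mathcal{C}_0\subset\bigotimes^4V^*$ is the space of algebraic curvature tensors: $R(x_1,x_2,x_3,x_4)$ antisymmetric in $x_1,x_2$ and in $x_3,x_4$, symmetric under exchange of the pairs $(x_1,x_2)$, $(x_3,x_4)$, and satisfying the first Bianchi identity. $\mathcal{C}_1\subset V^*\otimes\mathcal{C}_0$ is the space of those $(x;x_1,\dots,x_4)\mapsto\nabla_xR(x_1,x_2,x_3,x_4)$ that satisfy the second Bianchi identity (the cyclic sum over $x,x_1,x_2$ is zero). For $R\in\mathcal{C}_0$ the skew-adjoint endomorphism $R_{x,y}$ is given by $\langle R_{x,y}z,w\rangle=R(x,y,z,w)$. An endomorphism $B$ acts on $A\in\bigotimes^kV^*$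 by $(B\cdot A)(x_1,\dots,x_k)=-\sum_{i=1}^kA(x_1,\dots,Bx_i,\dots,x_k)$. An algebraic two-jet is a triple $(R,\nabla R,\nabla^{2)}R)$ with $R\in\mathcal{C}_0$, $\nabla R\in\mathcal{C}_1$, $\nabla^{2)}R\in V^*\otimes\mathcal{C}_1$ (written $(x,y)\mapsto\nabla^{2)}_{x,y}R\in\mathcal{C}_0$, with $(y;x_1,\dots,x_4)\mapsto\nabla^{2)}_{x,y}R(x_1,\dots,x_4)$ in $\mathcal{C}_1$ for each $x$) satisfying the Ricci identity $\nabla^{2)}_{x,y}R-\nabla^{2)}_{y,x}R=R_{x,y}\cdot R$ for all $x,y\in V$. Set $\mathrm{ric}(x,y)=-\sum_i\epsilon_iR(x,e_i,y,e_i)$, $\nabla_z\mathrm{ric}(x,y)=-\sum_i\epsilon_i\nabla_zR(x,e_i,y,e_i)$, $\nabla^{2)}_{z,w}\mathrm{ric}(x,y)=-\sum_i\epsilon_i\nabla^{2)}_{z,w}R(x,e_i,y,e_i)$. The two-jet is called Einstein if $\mathrm{ric}\in\mathbb{R}\langle\cdot,\cdot\rangle$, $\nabla\mathrm{ric}=0$ and $\nabla^{2)}\mathrm{ric}=0$. $R*R\in\mathcal{C}_0$ is defined by $(R*R)(x_1,\dots,x_4)=-\sum_{i=1}^4\sum_{j=1}^n\epsilon_j\,(R_{x_i,e_j}\cdot R)(x_1,\dots,e_j,\dots,x_4)$, with $e_j$ in the $i$-th slot. $\mathcal{R}^{2)}\in\mathrm{Sym}^4V^*\otimes\mathrm{Sym}^2V^*$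 is determined by polarization from $\mathcal{R}^{2)}(\xi,\xi,\xi,\xi;x,y)=\nabla^{2)}_{\xi,\xi}R(x,\xi,\xi,y)$. $\mathcal{R}*\mathcal{R}\in\mathrm{Sym}^2V^*\otimes\mathrm{Sym}^2V^*$ is the algebraic Jacobi operator of $R*R$, determined by $(\mathcal{R}*\mathcal{R})(\xi,\xi;x,y)=(R*R)(x,\xi,\xi,y)$. The symmetric product is taken as product of polynomials in $\xi$: $\big((\mathcal{R}*\mathcal{R})\odot\langle\cdot,\cdot\rangle\big)(\xi,\xi,\xi,\xi;x,y)=(R*R)(x,\xi,\xi,y)\,\langle\xi,\xi\rangle$. *)

theory Defs
  imports "HOL-Analysis.Linear_Algebra" "HOL-Combinatorics.Permutations"
begin

definition pseudo_euclidean :: "('v::real_vector \<Rightarrow> 'v \<Rightarrow> real) \<Rightarrow> bool" where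
  "pseudo_euclidean g \<longleftrightarrow>
     bilinear g \<and> (\<forall>x y. g x y = g y x) \<and> (\<forall>x. (\<forall>y. g x y = 0) \<longrightarrow> x = 0)"

definition orthonormal_basis ::
  "('v::real_vector \<Rightarrow> 'v \<Rightarrow> real) \<Rightarrow> nat \<Rightarrow> (nat \<Rightarrow> 'v) \<Rightarrow> bool" where
  "orthonormal_basis g n e \<longleftrightarrow>
     inj_on e {1..n} \<and> independent (e ` {1..n}) \<and> span (e ` {1..n}) = UNIV \<and>
     (\<forall>i\<in>{1..n}. \<forall>j\<in>{1..n}. i \<noteq> j \<longrightarrow> g (e i) (e j) = 0) \<and>
     (\<forall>i\<in>{1..n}. g (e i) (e i) \<in> {1, -1})"

type_synonym 'v tensor4 = "'v \<Rightarrow> 'v \<Rightarrow> 'v \<Rightarrow> 'v \<Rightarrow> real"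

definition curvature_tensors :: "'v::real_vector tensor4 set"  ("\<C>\<^sub>0") where
  "\<C>\<^sub>0 = {R.
     (\<forall>x2 x3 x4. linear (\<lambda>x. R x x2 x3 x4)) \<and>
     (\<forall>x1 x3 x4. linear (\<lambda>x. R x1 x x3 x4)) \<and>
     (\<forall>x1 x2 x4. linear (\<lambda>x. R x1 x2 x x4)) \<and>
     (\<forall>x1 x2 x3. linear (\<lambda>x. R x1 x2 x3 x)) \<and>
     (\<forall>x1 x2 x3 x4. R x1 x2 x3 x4 = - R x2 x1 x3 x4) \<and>
     (\<forall>x1 x2 x3 x4. R x1 x2 x3 x4 = - R x1 x2 x4 x3) \<and>
     (\<forall>x1 x2 x3 x4. R x1 x2 x3 x4 = R x3 x4 x1 x2) \<and>
     (\<forall>x1 x2 x3 x4. R x1 x2 x3 x4 + R x2 x3 x1 x4 + R x3 x1 x2 x4 = 0)}"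

definition curvature_derivatives :: "('v::real_vector \<Rightarrow> 'v tensor4) set"  ("\<C>\<^sub>1") where
  "\<C>\<^sub>1 = {dR.
     (\<forall>x1 x2 x3 x4. linear (\<lambda>x. dR x x1 x2 x3 x4)) \<and>
     (\<forall>x. dR x \<in> \<C>\<^sub>0) \<and>
     (\<forall>x x1 x2 x3 x4. dR x x1 x2 x3 x4 + dR x1 x2 x x3 x4 + dR x2 x x1 x3 x4 = 0)}"

text \<open>Well defined for \<open>R \<in> \<C>\<^sub>0\<close>, as \<open>g\<close> is nondegenerate and the space is finite-dimensional.\<close>

definition curvature_op ::
  "('v::real_vector \<Rightarrow> 'v \<Rightarrow> real) \<Rightarrow> 'v tensor4 \<Rightarrow> 'v \<Rightarrow> 'v \<Rightarrow> 'v \<Rightarrow> 'v" where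
  "curvature_op g R x y z = (THE u. \<forall>w. g u w = R x y z w)"

definition endo_act :: "('v \<Rightarrow> 'v) \<Rightarrow> 'v tensor4 \<Rightarrow> 'v tensor4" where
  "endo_act B A x1 x2 x3 x4 =
     - (A (B x1) x2 x3 x4 + A x1 (B x2) x3 x4 + A x1 x2 (B x3) x4 + A x1 x2 x3 (B x4))"

definition two_jet ::
  "('v::real_vector \<Rightarrow> 'v \<Rightarrow> real) \<Rightarrow>
     'v tensor4 \<Rightarrow> ('v \<Rightarrow> 'v tensor4) \<Rightarrow> ('v \<Rightarrow> 'v \<Rightarrow> 'v tensor4) \<Rightarrow> bool" where
  "two_jet g R dR ddR \<longleftrightarrow>
     R \<in> \<C>\<^sub>0 \<and> dR \<in> \<C>\<^sub>1 \<and>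
     (\<forall>y x1 x2 x3 x4. linear (\<lambda>x. ddR x y x1 x2 x3 x4)) \<and> (\<forall>x. ddR x \<in> \<C>\<^sub>1) \<and>
     (\<forall>x y x1 x2 x3 x4.
        ddR x y x1 x2 x3 x4 - ddR y x x1 x2 x3 x4
          = endo_act (curvature_op g R x y) R x1 x2 x3 x4)"

text \<open>Applied to \<open>R\<close>, \<open>\<nabla>\<^sub>z R\<close> and \<open>\<nabla>\<^sub>z\<^sub>,\<^sub>w R\<close>, this gives \<open>ric\<close>, \<open>\<nabla>\<^sub>z ric\<close> and \<open>\<nabla>\<^sub>z\<^sub>,\<^sub>w ric\<close>.\<close>

definition ric ::
  "('v::real_vector \<Rightarrow> 'v \<Rightarrow> real) \<Rightarrow> nat \<Rightarrow> (nat \<Rightarrow> 'v) \<Rightarrow> 'v tensor4 \<Rightarrow> 'v \<Rightarrow> 'v \<Rightarrow> real" where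
  "ric g n e R x y = - (\<Sum>i=1..n. g (e i) (e i) * R x (e i) y (e i))"

definition einstein_two_jet ::
  "('v::real_vector \<Rightarrow> 'v \<Rightarrow> real) \<Rightarrow> nat \<Rightarrow> (nat \<Rightarrow> 'v) \<Rightarrow>
     'v tensor4 \<Rightarrow> ('v \<Rightarrow> 'v tensor4) \<Rightarrow> ('v \<Rightarrow> 'v \<Rightarrow> 'v tensor4) \<Rightarrow> bool" where
  "einstein_two_jet g n e R dR ddR \<longleftrightarrow>
     (\<exists>c. \<forall>x y. ric g n e R x y = c * g x y) \<and>
     (\<forall>z x y. ric g n e (dR z) x y = 0) \<and>
     (\<forall>z w x y. ric g n e (ddR z w) x y = 0)"

definition curv_star ::
  "('v::real_vector \<Rightarrow> 'v \<Rightarrow> real) \<Rightarrow> nat \<Rightarrow> (nat \<Rightarrow> 'v) \<Rightarrow> 'v tensor4 \<Rightarrow> 'v tensor4" where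
  "curv_star g n e R x1 x2 x3 x4 =
     - ((\<Sum>j=1..n. g (e j) (e j) * endo_act (curvature_op g R x1 (e j)) R (e j) x2 x3 x4)
      + (\<Sum>j=1..n. g (e j) (e j) * endo_act (curvature_op g R x2 (e j)) R x1 (e j) x3 x4)
      + (\<Sum>j=1..n. g (e j) (e j) * endo_act (curvature_op g R x3 (e j)) R x1 x2 (e j) x4)
      + (\<Sum>j=1..n. g (e j) (e j) * endo_act (curvature_op g R x4 (e j)) R x1 x2 x3 (e j)))"

text \<open>
  Below, a tensor with slots \<open>1, \<dots>, k\<close> is a function of a family \<open>v\<close> that depends only on
  \<open>v 1, \<dots>, v k\<close>.

  For a multilinear \<open>F\<close>, \<open>symmetrize k F\<close> is the polarization of the polynomial
  \<open>\<xi> \<mapsto> F (\<xi>, \<dots>, \<xi>)\<close>, i.e. the only symmetric \<open>k\<close>-linear form with these values on the diagonal.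
\<close>

definition symmetrize :: "nat \<Rightarrow> ((nat \<Rightarrow> 'v) \<Rightarrow> real) \<Rightarrow> (nat \<Rightarrow> 'v) \<Rightarrow> real" where
  "symmetrize k F v = (\<Sum>\<sigma> | \<sigma> permutes {1..k}. F (v \<circ> \<sigma>)) / fact k"

lemma symmetrize_diag: "symmetrize k F (\<lambda>_. \<xi>) = F (\<lambda>_. \<xi>)"
proof -
  have "card {\<sigma>. \<sigma> permutes {1..k}} = fact k"
    by (rule card_permutations) auto
  then show ?thesis
    by (simp add: symmetrize_def comp_def)
qed

definition jacobi2 ::
  "('v \<Rightarrow> 'v \<Rightarrow> 'v tensor4) \<Rightarrow> (nat \<Rightarrow> 'v) \<Rightarrow> 'v \<Rightarrow> 'v \<Rightarrow> real" where
  "jacobi2 ddR v x y = symmetrize 4 (\<lambda>u. ddR (u 1) (u 2) x (u 3) (u 4) y) v"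

definition jacobi :: "'v tensor4 \<Rightarrow> (nat \<Rightarrow> 'v) \<Rightarrow> 'v \<Rightarrow> 'v \<Rightarrow> real" where
  "jacobi R v x y = symmetrize 2 (\<lambda>u. R x (u 1) (u 2) y) v"

definition sym_prod ::
  "((nat \<Rightarrow> 'v) \<Rightarrow> 'v \<Rightarrow> 'v \<Rightarrow> real) \<Rightarrow> ('v \<Rightarrow> 'v \<Rightarrow> real) \<Rightarrow> (nat \<Rightarrow> 'v) \<Rightarrow> 'v \<Rightarrow> 'v \<Rightarrow> real" where
  "sym_prod P g v x y = symmetrize 4 (\<lambda>u. P u x y * g (u 3) (u 4)) v"

lemma jacobi2_diag: "jacobi2 ddR (\<lambda>_. \<xi>) x y = ddR \<xi> \<xi> x \<xi> \<xi> y"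
  by (simp add: jacobi2_def symmetrize_diag)

lemma sym_prod_jacobi_diag: "sym_prod (jacobi R) g (\<lambda>_. \<xi>) x y = R x \<xi> \<xi> y * g \<xi> \<xi>"
  by (simp add: sym_prod_def jacobi_def symmetrize_diag)

definition totally_trace_free ::
  "('v::real_vector \<Rightarrow> 'v \<Rightarrow> real) \<Rightarrow> nat \<Rightarrow> (nat \<Rightarrow> 'v) \<Rightarrow> nat \<Rightarrow> ((nat \<Rightarrow> 'v) \<Rightarrow> real) \<Rightarrow> bool" where
  "totally_trace_free g n e k T \<longleftrightarrow>
     (\<forall>p\<in>{1..k}. \<forall>q\<in>{1..k}. p \<noteq> q \<longrightarrow>
        (\<forall>v. (\<Sum>i=1..n. g (e i) (e i) * T (v(p := e i, q := e i))) = 0))"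

end

theory Submission
  imports Defs
begin

text \<open>
  Both sides of the equivalence contain \<open>ric = \<kappa> g\<close> and \<open>\<nabla>ric = 0\<close>. What has to be shown is that,
  for a two-jet with \<open>ric = \<kappa> g\<close>, the tensor \<open>T\<close> of the theorem is totally trace-free if and only
  if \<open>\<nabla>\<^sup>2ric = 0\<close>. Call the four symmetric slots of \<open>T\<close> the \<open>\<xi>\<close>-slots and the other two slots
  \<open>x\<close> and \<open>y\<close>. Up to symmetry there are three contractions: over \<open>x, y\<close>, over a \<open>\<xi>\<close>-slot and \<open>x\<close>,
  and over two \<open>\<xi>\<close>-slots.

  The second Bianchi identity expresses the divergence and the Laplacian of \<open>R\<close> by \<open>\<nabla>\<^sup>2ric\<close> and by the
  commutators \<open>R\<^bsub>a,b\<^esub> \<cdot> R\<close> of the Ricci identity. Contracted commutators are of the form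
  \<open>(\<Sum>i. \<epsilon>\<^sub>i (R\<^bsub>e\<^sub>i,a\<^esub> \<cdot> R)(e\<^sub>i, b, c, d))\<close>, called \<open>div_act\<close> below. Two facts about them follow from
  \<open>ric = \<kappa> g\<close> alone:

    \<^item> \<open>ric_curv_act\<close>: \<open>R\<^bsub>a,b\<^esub> \<cdot> ric = 0\<close>. Hence \<open>\<nabla>\<^sup>2ric\<close> is symmetric in its two derivative slots, and
      \<open>R*R\<close> has no Ricci trace (\<open>ric_Q\<close>).
    \<^item> \<open>div_act_cubic\<close>: \<open>div_act\<close> vanishes if its first three arguments agree.

  They make the commutators drop out of all three contractions of \<open>T\<close>. The factor \<open>1 / (n + 4)\<close> is the
  one for which this happens: for a trace-free \<open>Q\<close>, the Laplacian in \<open>\<xi>\<close> of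
  \<open>Q(x, \<xi>, \<xi>, y) g(\<xi>, \<xi>)\<close> is \<open>2 (n + 4) Q(x, \<xi>, \<xi>, y)\<close>, and the commutators in the Laplacian in \<open>\<xi>\<close>
  of \<open>\<nabla>\<^sup>2\<^bsub>\<xi>,\<xi>\<^esub>R(x, \<xi>, \<xi>, y)\<close> add up to \<open>2 (R*R)(x, \<xi>, \<xi>, y)\<close>.

  What remains of the contractions are linear expressions in \<open>P = \<nabla>\<^sup>2ric\<close>
  (\<open>obstruction_trace_xy\<close>, \<open>obstruction_trace_xi_x\<close>, \<open>obstruction_trace_xi_xi\<close>). They vanish if \<open>P\<close> does.
  Conversely, evaluated on \<open>\<xi>, \<xi>, x, y\<close>, they form a linear system with only the zero solution for
  \<open>P(\<xi>, \<xi>; x, y)\<close>, \<open>P(x, y; \<xi>, \<xi>)\<close>, \<open>P(\<xi>, x; \<xi>, y)\<close> and \<open>P(\<xi>, y; \<xi>, x)\<close>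
  (\<open>ddric_zero_if_traces_zero\<close>). The third kind of contraction is essential here: the first
  two leave free the component of \<open>P\<close> that has the symmetries of a curvature tensor.
\<close>

section \<open>Curvature tensors and symmetrization\<close>

lemma
  assumes "R \<in> \<C>\<^sub>0"
  shows curv_linear1: "linear (\<lambda>x. R x x2 x3 x4)"
    and curv_linear2: "linear (\<lambda>x. R x1 x x3 x4)"
    and curv_linear3: "linear (\<lambda>x. R x1 x2 x x4)"
    and curv_linear4: "linear (\<lambda>x. R x1 x2 x3 x)"
    and curv_skew12: "R x1 x2 x3 x4 = - R x2 x1 x3 x4"
    and curv_skew34: "R x1 x2 x3 x4 = - R x1 x2 x4 x3"
    and curv_pair: "R x1 x2 x3 x4 = R x3 x4 x1 x2"
  subgoal using assms unfolding curvature_tensors_def mem_Collect_eq by (elim conjE allE)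
  subgoal using assms unfolding curvature_tensors_def mem_Collect_eq by (elim conjE allE)
  subgoal using assms unfolding curvature_tensors_def mem_Collect_eq by (elim conjE allE)
  subgoal using assms unfolding curvature_tensors_def mem_Collect_eq by (elim conjE allE)
  using assms unfolding curvature_tensors_def mem_Collect_eq by blast+

lemmas curv_linear = curv_linear1 curv_linear2 curv_linear3 curv_linear4

lemma curv_flip: "R \<in> \<C>\<^sub>0 \<Longrightarrow> R x1 x2 x3 x4 = R x2 x1 x4 x3"
  using curv_skew12[of R x1 x2 x3 x4] curv_skew34[of R x2 x1 x3 x4] by simp

definition perm_sum3 :: "('v \<Rightarrow> 'v \<Rightarrow> 'v \<Rightarrow> real) \<Rightarrow> 'v \<Rightarrow> 'v \<Rightarrow> 'v \<Rightarrow> real" where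
  "perm_sum3 f a b c = f a b c + f a c b + f b a c + f b c a + f c a b + f c b a"

definition perm_sum4 :: "('v \<Rightarrow> 'v \<Rightarrow> 'v \<Rightarrow> 'v \<Rightarrow> real) \<Rightarrow> 'v \<Rightarrow> 'v \<Rightarrow> 'v \<Rightarrow> 'v \<Rightarrow> real" where
  "perm_sum4 f a b c d =
     perm_sum3 (f a) b c d + perm_sum3 (f b) a c d + perm_sum3 (f c) a b d + perm_sum3 (f d) a b c"

lemma perm_sum4_swap:
  "perm_sum4 f a b c d = perm_sum4 f b a c d"
  "perm_sum4 f a b c d = perm_sum4 f a c b d"
  "perm_sum4 f a b c d = perm_sum4 f a b d c"
  by (simp_all add: perm_sum4_def perm_sum3_def)

text \<open>
  Here the arguments are permuted inside the summand. This compares the polarizations of different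
  multilinear forms with the same diagonal.
\<close>
lemma perm_sum4_relabel:
  "perm_sum4 (\<lambda>a b c d. f b a c d) a b c d = perm_sum4 f a b c d"
  "perm_sum4 (\<lambda>a b c d. f a b d c) a b c d = perm_sum4 f a b c d"
  by (simp_all add: perm_sum4_def perm_sum3_def)

lemma symmetrize_2:
  "symmetrize 2 (\<lambda>u. f (u 1) (u 2)) v = (f (v 1) (v 2) + f (v 2) (v 1)) / 2"
proof -
  have S: "{1..2::nat} = insert 1 (insert 2 {})" by auto
  show ?thesis
    unfolding symmetrize_def S
    by (simp add: sum_over_permutations_insert fact_numeral transpose_def)
qed

lemma symmetrize_4:
  "symmetrize 4 (\<lambda>u. f (u 1) (u 2) (u 3) (u 4)) v
     = perm_sum4 f (v 1) (v 2) (v 3) (v 4) / 24"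
proof -
  have S: "{1..4::nat} = insert 1 (insert 2 (insert 3 (insert 4 {})))" by auto
  have F: "fact 4 = (24::real)" by (simp add: fact_numeral)
  show ?thesis
    unfolding symmetrize_def S F perm_sum4_def perm_sum3_def
    by (simp add: sum_over_permutations_insert transpose_def)
qed

text \<open>
  Polarization of a cubic form: the sum over permutations is an alternating sum of diagonal values.
\<close>
lemma perm_sum3_zero:
  fixes f :: "'v::real_vector \<Rightarrow> 'v \<Rightarrow> 'v \<Rightarrow> real"
  assumes lin: "\<And>b c. linear (\<lambda>a. f a b c)" "\<And>a c. linear (\<lambda>b. f a b c)" "\<And>a b. linear (\<lambda>c. f a b c)"
    and diag: "\<And>x. f x x x = 0"
  shows "perm_sum3 f a b c = 0"
proof -
  note add = lin[THEN linear_add]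
  have "perm_sum3 f a b c = f (a + b + c) (a + b + c) (a + b + c)
      - f (a + b) (a + b) (a + b) - f (a + c) (a + c) (a + c) - f (b + c) (b + c) (b + c)
      + f a a a + f b b b + f c c c"
    unfolding perm_sum3_def add by simp
  then show ?thesis by (simp add: diag)
qed

section \<open>Traces over an orthonormal basis\<close>
locale orthonormal_frame =
  fixes g :: "'v::real_vector \<Rightarrow> 'v \<Rightarrow> real" and n :: nat and e :: "nat \<Rightarrow> 'v"
  assumes metric: "pseudo_euclidean g"
    and frame: "orthonormal_basis g n e"
begin

text \<open>
  A contraction over two slots is the trace of a quadratic map of a single vector; with one bound variable
  in place of two, both occurrences move through the symmetries of a tensor without renaming.
\<close>
definition tr :: "('v \<Rightarrow> real) \<Rightarrow> real" where
  "tr f = (\<Sum>i=1..n. g (e i) (e i) * f (e i))"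

lemma tr_add: "tr (\<lambda>i. f i + h i) = tr f + tr h"
  by (simp add: tr_def distrib_left sum.distrib)

lemma tr_minus: "tr (\<lambda>i. - f i) = - tr f"
  by (simp add: tr_def sum_negf)

lemma tr_diff: "tr (\<lambda>i. f i - h i) = tr f - tr h"
  by (simp add: tr_def right_diff_distrib sum_subtractf)

lemma tr_scale: "tr (\<lambda>i. k * f i) = k * tr f" "tr (\<lambda>i. f i * k) = tr f * k"
  by (simp_all add: tr_def sum_distrib_left sum_distrib_right algebra_simps)

lemma tr_divide: "tr (\<lambda>i. f i / k) = tr f / k"
  by (simp add: tr_def sum_divide_distrib)

lemma tr_zero: "tr (\<lambda>i. 0) = 0"
  by (simp add: tr_def)

lemmas tr_simps = tr_add tr_minus tr_diff tr_scale tr_divide tr_zero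

lemma tr_swap: "tr (\<lambda>i. tr (\<lambda>k. f i k)) = tr (\<lambda>k. tr (\<lambda>i. f i k))"
  unfolding tr_def sum_distrib_left by (subst sum.swap) (simp add: algebra_simps)

lemma linear_tr: "(\<And>i. linear (\<lambda>x. f x i)) \<Longrightarrow> linear (\<lambda>x. tr (f x))"
  unfolding tr_def by (intro linear_compose_sum ballI linear_compose_scale_right[where 'b=real, simplified]) auto

lemma bilinear_g: "bilinear g" and g_sym: "g x y = g y x"
  and g_nondegenerate: "(\<And>y. g x y = 0) \<Longrightarrow> x = 0"
  using metric by (auto simp: pseudo_euclidean_def)

lemma frame_orthogonal: "i \<in> {1..n} \<Longrightarrow> j \<in> {1..n} \<Longrightarrow> i \<noteq> j \<Longrightarrow> g (e i) (e j) = 0"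
  and frame_unit: "i \<in> {1..n} \<Longrightarrow> g (e i) (e i) * g (e i) (e i) = 1"
  using frame unfolding orthonormal_basis_def by fastforce+

lemma linear_g: "linear (\<lambda>x. g x y)" "linear (g x)"
  using bilinear_g by (auto simp: bilinear_def)

lemma frame_expansion: "w = (\<Sum>i=1..n. (g (e i) (e i) * g (e i) w) *\<^sub>R e i)"
proof -
  have lin: "linear (\<lambda>w. \<Sum>i=1..n. (g (e i) (e i) * g (e i) w) *\<^sub>R e i)"
    by (rule linearI)
      (simp_all add: linear_g[THEN linear_add] linear_g[THEN linear_scale] algebra_simps
        sum.distrib scaleR_sum_right)
  have "w \<in> span (e ` {1..n})"
    using frame by (simp add: orthonormal_basis_def)
  show ?thesis
  proof (rule linear_eq_on_span[OF linear_ident lin _ \<open>w \<in> span (e ` {1..n})\<close>])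
    fix b assume "b \<in> e ` {1..n}"
    then obtain k where k: "k \<in> {1..n}" "b = e k" by blast
    have "(\<Sum>i=1..n. (g (e i) (e i) * g (e i) b) *\<^sub>R e i)
        = (\<Sum>i=1..n. if i = k then e k else 0)"
      using k frame_orthogonal frame_unit by (intro sum.cong) auto
    then show "b = (\<Sum>i=1..n. (g (e i) (e i) * g (e i) b) *\<^sub>R e i)"
      using k by simp
  qed
qed

text \<open>
  Raising an index: contracting a slot with the metric substitutes the other argument of the metric.
\<close>
lemma tr_metric:
  assumes "linear f" shows "tr (\<lambda>i. g i w * f i) = f w"
proof -
  have "f w = f (\<Sum>i=1..n. (g (e i) (e i) * g (e i) w) *\<^sub>R e i)"
    using frame_expansion[of w] by (rule arg_cong)
  also have "\<dots> = tr (\<lambda>i. g i w * f i)"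
    by (simp add: tr_def linear_sum[OF assms] linear_scale[OF assms] mult.assoc)
  finally show ?thesis by simp
qed

lemma tr_dimension: "tr (\<lambda>i. g i i) = real n"
  by (simp add: tr_def frame_unit)

lemma ric_tr: "ric g n e A x y = - tr (\<lambda>i. A x i y i)"
  by (simp add: ric_def tr_def)

lemma curvature_op_eq:
  assumes "A \<in> \<C>\<^sub>0"
  shows "curvature_op g A x y z = (\<Sum>i=1..n. (g (e i) (e i) * A x y z (e i)) *\<^sub>R e i)"
proof -
  define u where "u = (\<Sum>i=1..n. (g (e i) (e i) * A x y z (e i)) *\<^sub>R e i)"
  have u: "g u w = A x y z w" for w
  proof -
    have "g u w = tr (\<lambda>i. g i w * A x y z i)"
      by (simp add: u_def tr_def linear_sum[OF linear_g(1)] linear_scale[OF linear_g(1)] algebra_simps)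
    then show ?thesis
      by (simp add: tr_metric curv_linear[OF assms])
  qed
  have "u' = u" if "\<forall>w. g u' w = A x y z w" for u'
  proof -
    have "g (u' - u) w = 0" for w
      using that by (simp add: u linear_diff[OF linear_g(1)])
    from g_nondegenerate[OF this] show ?thesis by simp
  qed
  then have "curvature_op g A x y z = u"
    unfolding curvature_op_def using u by (intro the_equality) auto
  then show ?thesis by (simp only: u_def)
qed

text \<open>
  The value \<open>R\<^bsub>x,y\<^esub> z\<close> is determined only by its inner products, so a form is evaluated on it by a
  contraction. This turns \<open>endo_act (curvature_op g R x y)\<close> into an expression quadratic in \<open>R\<close>.
\<close>
lemma apply_curvature_op:
  assumes "A \<in> \<C>\<^sub>0" "linear f"
  shows "f (curvature_op g A x y z) = tr (\<lambda>k. A x y z k * f k)"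
  by (simp add: curvature_op_eq[OF assms(1)] linear_sum[OF assms(2)] linear_scale[OF assms(2)]
      tr_def mult.assoc)

end

section \<open>Curvature acting on curvature\<close>
locale einstein_curvature = orthonormal_frame +
  fixes R :: "'a tensor4" and \<kappa> :: real
  assumes R: "R \<in> \<C>\<^sub>0"
    and einstein: "ric g n e R x y = \<kappa> * g x y"
begin

definition curv_act :: "'a \<Rightarrow> 'a \<Rightarrow> 'a tensor4" where
  "curv_act a b = endo_act (curvature_op g R a b) R"

text \<open>
  All contracted commutators occurring in divergences and Laplacians of the two-jet, and all terms of \<open>R*R\<close>,
  are values of this one tensor.
\<close>
definition div_act :: "'a tensor4" where
  "div_act a x1 x2 x3 = tr (\<lambda>i. curv_act i a i x1 x2 x3)"

abbreviation "Q \<equiv> curv_star g n e R"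

lemma tr_R: "tr (\<lambda>i. R x i y i) = - \<kappa> * g x y"
  using einstein[of x y] by (simp add: ric_tr)

lemma tr_R_apply: "tr (\<lambda>k. R a b x k * (z * g y k)) = z * R a b x y"
  using tr_metric[OF curv_linear4[OF R], of y a b x] tr_scale(1)[of z "\<lambda>k. g k y * R a b x k"]
  by (simp add: g_sym[of y] algebra_simps)

lemma curv_act_eq: "curv_act a b x1 x2 x3 x4 =
  - (tr (\<lambda>k. R a b x1 k * R k x2 x3 x4) + tr (\<lambda>k. R a b x2 k * R x1 k x3 x4)
   + tr (\<lambda>k. R a b x3 k * R x1 x2 k x4) + tr (\<lambda>k. R a b x4 k * R x1 x2 x3 k))"
  unfolding curv_act_def endo_act_def
  by (simp add: apply_curvature_op[OF R curv_linear(1)[OF R]] apply_curvature_op[OF R curv_linear(2)[OF R]]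
      apply_curvature_op[OF R curv_linear(3)[OF R]] apply_curvature_op[OF R curv_linear(4)[OF R]])

text \<open>
  The trace of \<open>R\<^bsub>a,b\<^esub> \<cdot> R\<close> is \<open>R\<^bsub>a,b\<^esub> \<cdot> ric\<close>, because \<open>R\<^bsub>a,b\<^esub>\<close> is skew-adjoint and the terms acting on the
  two contracted slots cancel; and \<open>R\<^bsub>a,b\<^esub> \<cdot> g = 0\<close>.
\<close>
lemma ric_curv_act: "tr (\<lambda>i. curv_act a b x i y i) = 0"
proof -
  have 1: "tr (\<lambda>i. tr (\<lambda>k. R a b x k * R k i y i)) = - \<kappa> * R a b x y"
    by (subst tr_swap) (simp add: tr_simps tr_R tr_R_apply g_sym[of _ y])
  have 3: "tr (\<lambda>i. tr (\<lambda>k. R a b y k * R x i k i)) = - \<kappa> * R a b y x"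
    by (subst tr_swap) (simp add: tr_simps tr_R tr_R_apply)
  have "tr (\<lambda>i. tr (\<lambda>k. R a b i k * R x i y k)) = tr (\<lambda>k. tr (\<lambda>i. - R a b k i * R x i y k))"
    by (subst tr_swap, subst curv_skew34[OF R]) (rule refl)
  then have 24: "tr (\<lambda>i. tr (\<lambda>k. R a b i k * R x k y i)) + tr (\<lambda>i. tr (\<lambda>k. R a b i k * R x i y k)) = 0"
    by (simp add: tr_simps)
  show ?thesis
    using 1 3 24 curv_skew34[OF R, of a b x y] by (simp add: curv_act_eq tr_simps)
qed

text \<open>
  Of the four terms of the action, the first contains the Ricci tensor, which gives \<open>\<kappa> R(x, x, x, y) = 0\<close>.
  The second contracts \<open>R(i, x, x, k)\<close>, symmetric in \<open>i\<close> and \<open>k\<close>, with \<open>R(i, k, x, y)\<close>, which is skew. The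
  last two contract \<open>R(i, x, x, k)\<close> with \<open>R(i, x, k, y)\<close> with opposite signs.
\<close>
lemma div_act_cubic: "div_act x x x y = 0"
proof -
  have 1: "tr (\<lambda>i. tr (\<lambda>k. R i x i k * R k x x y)) = 0"
  proof -
    have "tr (\<lambda>i. R i x i k) = - \<kappa> * g x k" for k
    proof -
      have "R i x i k = R x i k i" for i by (rule curv_flip[OF R])
      then show ?thesis by (simp add: tr_R)
    qed
    moreover have "R x x x y = 0" using curv_skew12[OF R, of x x x y] by simp
    ultimately show ?thesis
      using tr_metric[OF curv_linear1[OF R], of x x x y] tr_scale(1)[of \<kappa> "\<lambda>k. g k x * R k x x y"]
      by (subst tr_swap) (simp add: tr_simps g_sym[of x] algebra_simps)
  qed
  have 2: "tr (\<lambda>i. tr (\<lambda>k. R i x x k * R i k x y)) = 0"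
  proof -
    have "R i x x k * R i k x y = - (R k x x i * R k i x y)" for i k
    proof -
      have "R i x x k = R k x x i"
        using curv_flip[OF R, of i x x k] curv_pair[OF R, of x i k x] by linarith
      then show ?thesis
        using curv_skew12[OF R, of i k x y] by simp
    qed
    then have "tr (\<lambda>i. tr (\<lambda>k. R i x x k * R i k x y))
        = - tr (\<lambda>i. tr (\<lambda>k. R k x x i * R k i x y))"
      unfolding tr_minus[symmetric] by (intro arg_cong[where f=tr] ext)
    then show ?thesis
      using tr_swap[of "\<lambda>i k. R i x x k * R i k x y"] by linarith
  qed
  have 34: "R i x y k * R i x x k = - (R i x x k * R i x k y)" for i k
    using curv_skew34[OF R, of i x y k] by simp
  show ?thesis
    by (simp add: div_act_def curv_act_eq tr_simps 1 2 34)
qed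

end

section \<open>Contractions of an algebraic two-jet\<close>
locale einstein_two_jet_frame = einstein_curvature +
  fixes dR :: "'a \<Rightarrow> 'a tensor4" and D :: "'a \<Rightarrow> 'a \<Rightarrow> 'a tensor4"
  assumes jet: "two_jet g R dR D"
begin

definition ddric :: "'a tensor4" where
  "ddric a b = ric g n e (D a b)"

lemma D_linear0: "linear (\<lambda>a. D a b x1 x2 x3 x4)"
  and D_C1: "D a \<in> \<C>\<^sub>1"
  and ricci_identity: "D a b x1 x2 x3 x4 = D b a x1 x2 x3 x4 + curv_act a b x1 x2 x3 x4"
proof -
  note parts = jet[unfolded two_jet_def]
  show "linear (\<lambda>a. D a b x1 x2 x3 x4)"
    by (rule parts[THEN conjunct2, THEN conjunct2, THEN conjunct1, rule_format])
  show "D a \<in> \<C>\<^sub>1"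
    by (rule parts[THEN conjunct2, THEN conjunct2, THEN conjunct2, THEN conjunct1, rule_format])
  have "D a b x1 x2 x3 x4 - D b a x1 x2 x3 x4 = curv_act a b x1 x2 x3 x4"
    unfolding curv_act_def
    by (rule parts[THEN conjunct2, THEN conjunct2, THEN conjunct2, THEN conjunct2, rule_format])
  then show "D a b x1 x2 x3 x4 = D b a x1 x2 x3 x4 + curv_act a b x1 x2 x3 x4"
    by linarith
qed

lemma D_linear1: "linear (\<lambda>b. D a b x1 x2 x3 x4)"
  and D_C0: "D a b \<in> \<C>\<^sub>0"
  and second_bianchi: "D a x1 x2 x3 y z + D a x2 x3 x1 y z + D a x3 x1 x2 y z = 0"
proof -
  note parts = D_C1[of a, unfolded curvature_derivatives_def mem_Collect_eq]
  show "linear (\<lambda>b. D a b x1 x2 x3 x4)"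
    by (rule parts[THEN conjunct1, rule_format])
  show "D a b \<in> \<C>\<^sub>0"
    by (rule parts[THEN conjunct2, THEN conjunct1, rule_format])
  show "D a x1 x2 x3 y z + D a x2 x3 x1 y z + D a x3 x1 x2 y z = 0"
    by (rule parts[THEN conjunct2, THEN conjunct2, rule_format])
qed

lemmas D_linear = D_linear0 D_linear1 curv_linear[OF D_C0]
lemmas D_skew12 = curv_skew12[OF D_C0] and D_skew34 = curv_skew34[OF D_C0]
  and D_pair = curv_pair[OF D_C0] and D_flip = curv_flip[OF D_C0]

text \<open>
  As a difference of second derivatives, \<open>R\<^bsub>a,b\<^esub> \<cdot> R\<close> inherits multilinearity and the symmetries of a
  curvature tensor.
\<close>
lemma curv_act_eq_D: "curv_act a b = (\<lambda>x1 x2 x3 x4. D a b x1 x2 x3 x4 - D b a x1 x2 x3 x4)"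
  using ricci_identity[of a b] by (intro ext) simp

lemma ddric_tr: "ddric a b x y = - tr (\<lambda>i. D a b x i y i)"
  by (simp add: ddric_def ric_tr)

text \<open>
  The skew part in the two derivative slots is \<open>R\<^bsub>a,b\<^esub> \<cdot> ric = 0\<close>, by the Ricci identity.
\<close>
lemma ddric_sym12: "ddric a b x y = ddric b a x y"
  using ric_curv_act[of a b x y] by (simp add: curv_act_eq_D tr_simps ddric_tr)

lemma ddric_sym34: "ddric a b x y = ddric a b y x"
proof -
  have "(\<lambda>i. D a b x i y i) = (\<lambda>i. D a b y i x i)"
    by (intro ext D_pair)
  then show ?thesis by (simp add: ddric_tr)
qed

lemma ddric_linear: "linear (\<lambda>a. ddric a b x y)"
  unfolding ddric_tr by (intro linear_compose_neg linear_tr D_linear)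

lemma div_act_linear: "linear (\<lambda>a. div_act a x1 x2 x3)" "linear (\<lambda>x. div_act a x x2 x3)"
    "linear (\<lambda>x. div_act a x1 x x3)" "linear (\<lambda>x. div_act a x1 x2 x)"
  unfolding div_act_def curv_act_eq_D by (intro linear_tr linear_compose_sub D_linear)+

lemma div_act_skew: "div_act a x1 x2 x3 = - div_act a x1 x3 x2"
proof -
  have "curv_act i a i x1 x2 x3 = - curv_act i a i x1 x3 x2" for i
    unfolding curv_act_eq_D using D_skew34[of i a i x1 x2 x3] D_skew34[of a i i x1 x2 x3] by linarith
  then show ?thesis
    unfolding div_act_def tr_minus[symmetric] by (intro arg_cong[where f=tr] ext)
qed

lemma div_act_perm_sum: "perm_sum3 (\<lambda>a b c. div_act a b c y) a b c = 0"
  by (rule perm_sum3_zero; rule div_act_linear div_act_cubic)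

text \<open>
  The four slots of \<open>R*R\<close> contribute the same tensor, with the arguments moved by the symmetries of a
  curvature tensor.
\<close>
lemma Q_eq: "Q x1 x2 x3 x4 = div_act x1 x2 x3 x4 - div_act x2 x1 x3 x4 + div_act x3 x4 x1 x2 - div_act x4 x3 x1 x2"
proof -
  have K1: "curv_act x i i y z w = - curv_act i x i y z w" for x i y z w
    by (simp add: curv_act_eq_D)
  have K2: "curv_act x i y i z w = curv_act i x i y z w" for x i y z w
    unfolding curv_act_eq_D using D_skew12[of x i y i z w] D_skew12[of i x y i z w] by linarith
  have K3: "curv_act x i y z i w = - curv_act i x i w y z" for x i y z w
    unfolding curv_act_eq_D using D_pair[of x i y z i w] D_pair[of i x y z i w] by linarith
  have K4: "curv_act x i y z w i = curv_act i x i w y z" for x i y z w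
    unfolding curv_act_eq_D using D_pair[of x i y z w i] D_pair[of i x y z w i]
      D_skew12[of x i w i y z] D_skew12[of i x w i y z] by linarith
  have "Q x1 x2 x3 x4 = - (tr (\<lambda>i. curv_act x1 i i x2 x3 x4) + tr (\<lambda>i. curv_act x2 i x1 i x3 x4)
      + tr (\<lambda>i. curv_act x3 i x1 x2 i x4) + tr (\<lambda>i. curv_act x4 i x1 x2 x3 i))"
    by (simp only: curv_star_def tr_def curv_act_def)
  then show ?thesis
    by (simp add: K1 K2 K3 K4 tr_simps div_act_def)
qed

lemma Q_skew12: "Q x1 x2 x3 x4 = - Q x2 x1 x3 x4"
  using div_act_skew[of x3 x4 x1 x2] div_act_skew[of x4 x3 x1 x2] by (simp add: Q_eq)

lemma Q_pair: "Q x1 x2 x3 x4 = Q x3 x4 x1 x2"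
  by (simp add: Q_eq)

lemma Q_linear: "linear (\<lambda>x. Q x x2 x3 x4)" "linear (\<lambda>x. Q x1 x x3 x4)" "linear (\<lambda>x. Q x1 x2 x x4)"
  unfolding Q_eq by (intro linear_compose_sub linear_compose_add div_act_linear)+

text \<open>
  Contracting the outer slots of \<open>Q_eq\<close> over \<open>i\<close>: the terms with \<open>i\<close> in the first argument of \<open>div_act\<close> cancel
  each other, since \<open>R\<^bsub>k,i\<^esub> \<cdot> R\<close> is skew in \<open>k, i\<close> and symmetric under exchange of pairs. The other two are
  traces of \<open>R\<^bsub>k,a\<^esub> \<cdot> ric = 0\<close>.
\<close>
lemma ric_Q: "tr (\<lambda>i. Q i x y i) = 0"
proof -
  have U2: "tr (\<lambda>i. div_act a i y i) = 0" for a y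
    by (simp add: div_act_def ric_curv_act tr_simps, subst tr_swap, simp add: ric_curv_act tr_simps)
  have U2': "tr (\<lambda>i. div_act a i i y) = 0" for a y
  proof -
    have "(\<lambda>i. div_act a i i y) = (\<lambda>i. - div_act a i y i)"
      by (intro ext div_act_skew)
    then show ?thesis using U2[of a y] by (simp add: tr_simps)
  qed
  have pt: "curv_act k i k x y i = - curv_act i k i y x k" for i k x y
    unfolding curv_act_eq_D using D_pair[of k i k x y i] D_flip[of k i y i k x] D_pair[of i k k x y i] D_flip[of i k y i k x]
    by linarith
  have "tr (\<lambda>i. div_act i x y i) = - tr (\<lambda>i. div_act i y x i)"
    unfolding div_act_def tr_minus[symmetric]
    by (subst tr_swap) (intro arg_cong[where f=tr] ext pt)
  moreover have "tr (\<lambda>i. div_act i y i x) = - tr (\<lambda>i. div_act i y x i)"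
    unfolding tr_minus[symmetric] by (intro arg_cong[where f=tr] ext div_act_skew)
  ultimately show ?thesis
    by (simp add: Q_eq tr_simps U2 U2')
qed

text \<open>
  Contracted second Bianchi identity, applied to \<open>\<nabla>\<^sub>z\<close> of the first derivative.
\<close>
lemma divergence: "tr (\<lambda>i. D z i i b c d) = ddric z d c b - ddric z c d b"
proof -
  have "D z i i b c d = D z c d i b i - D z d c i b i" for i
    using D_pair[of z i i b c d] second_bianchi[of z i c d i b]
      D_skew34[of z c d i i b] D_flip[of z d i c i b] by linarith
  then show ?thesis
    by (simp add: tr_simps ddric_tr)
qed

text \<open>
  With the derivatives in the other order, the Ricci identity adds a commutator.
\<close>
lemma divergence': "tr (\<lambda>i. D i z i b c d) = ddric z d c b - ddric z c d b + div_act z b c d"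
proof -
  have "tr (\<lambda>i. D i z i b c d) = tr (\<lambda>i. D z i i b c d) + tr (\<lambda>i. curv_act i z i b c d)"
    by (subst ricci_identity) (rule tr_add)
  then show ?thesis by (simp add: divergence div_act_def)
qed

text \<open>
  The second Bianchi identity rotates the inner derivative into the first pair of slots, which leaves two
  divergences.
\<close>
lemma laplacian:
  "tr (\<lambda>i. D i i x y z w) = div_act x y z w - div_act y x z w
     + (ddric x w z y - ddric x z w y) - (ddric y w z x - ddric y z w x)"
proof -
  have "D i i x y z w = D i x i y z w - D i y i x z w" for i
    using second_bianchi[of i i x y z w] D_skew12[of i x y i z w] by linarith
  then show ?thesis
    by (simp add: tr_simps divergence')
qed

section \<open>The three contractions\<close>

text \<open>
  The tensor of the theorem, written out as a sum over permutations. In the second sum it suffices to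
  symmetrize \<open>Q(x, a, b, y)\<close> together with the metric, as this already symmetrizes \<open>a, b\<close>.
\<close>
definition obstruction :: "'a \<Rightarrow> 'a \<Rightarrow> 'a tensor4" where
  "obstruction a b c d x y = (perm_sum4 (\<lambda>a b c d. D a b x c d y) a b c d
    - 1 / (real n + 4) * perm_sum4 (\<lambda>a b c d. Q x a b y * g c d) a b c d) / 24"

lemma obstruction_eq:
  "jacobi2 D v x y - 1 / (real n + 4) * sym_prod (jacobi Q) g v x y
     = obstruction (v 1) (v 2) (v 3) (v 4) x y"
proof -
  have J: "jacobi Q u x y = (Q x (u 1) (u 2) y + Q x (u 2) (u 1) y) / 2" for u
    unfolding jacobi_def by (rule symmetrize_2)
  have 1: "jacobi2 D v x y = perm_sum4 (\<lambda>a b c d. D a b x c d y) (v 1) (v 2) (v 3) (v 4) / 24"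
    unfolding jacobi2_def by (rule symmetrize_4)
  have "sym_prod (jacobi Q) g v x y
    = perm_sum4 (\<lambda>a b c d. (Q x a b y + Q x b a y) / 2 * g c d) (v 1) (v 2) (v 3) (v 4) / 24"
    unfolding sym_prod_def J by (rule symmetrize_4)
  also have "perm_sum4 (\<lambda>a b c d. (Q x a b y + Q x b a y) / 2 * g c d) a b c d
    = (perm_sum4 (\<lambda>a b c d. Q x a b y * g c d) a b c d
       + perm_sum4 (\<lambda>a b c d. Q x b a y * g c d) a b c d) / 2" for a b c d
    by (simp add: perm_sum4_def perm_sum3_def add_divide_distrib distrib_right)
  also have "perm_sum4 (\<lambda>a b c d. Q x b a y * g c d) a b c d
    = perm_sum4 (\<lambda>a b c d. Q x a b y * g c d) a b c d" for a b c d
    by (rule perm_sum4_relabel)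
  finally have 2: "sym_prod (jacobi Q) g v x y
    = perm_sum4 (\<lambda>a b c d. Q x a b y * g c d) (v 1) (v 2) (v 3) (v 4) / 24"
    by simp
  show ?thesis
    unfolding 1 2 obstruction_def by (simp add: diff_divide_distrib)
qed

lemma obstruction_swap:
  "obstruction a b c d x y = obstruction b a c d x y"
  "obstruction a b c d x y = obstruction a c b d x y"
  "obstruction a b c d x y = obstruction a b d c x y"
  unfolding obstruction_def
  by (intro arg_cong2[where f="\<lambda>s t. (s - 1 / (real n + 4) * t) / 24"] perm_sum4_swap)+

lemma obstruction_swap_xy: "obstruction a b c d x y = obstruction a b c d y x"
proof -
  have D: "D a b x c d y = D a b y d c x" for a b c d
    using D_pair[of a b x c d y] D_flip[of a b d y x c] by simp
  have Q: "Q x a b y = Q y b a x" for a b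
    using Q_pair[of x a b y] Q_skew12[of b y x a] Q_pair[of y b x a] Q_skew12[of x a y b]
      Q_pair[of a x y b] by simp
  have "perm_sum4 (\<lambda>a b c d. D a b x c d y) a b c d = perm_sum4 (\<lambda>a b c d. D a b y c d x) a b c d"
    unfolding D by (rule perm_sum4_relabel)
  moreover have "perm_sum4 (\<lambda>a b c d. Q x a b y * g c d) a b c d
      = perm_sum4 (\<lambda>a b c d. Q y a b x * g c d) a b c d"
    unfolding Q by (rule perm_sum4_relabel)
  ultimately show ?thesis
    unfolding obstruction_def by simp
qed

text \<open>
  Every contraction of \<open>\<nabla>\<^sup>2R\<close> occurring in the traces of \<open>obstruction\<close>, brought to one of the cases above
  by the symmetries of \<open>R\<close>.
\<close>
lemma tr_ddR:
  "tr (\<lambda>i. D z i b i c d) = - (ddric z d c b - ddric z c d b)"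
  "tr (\<lambda>i. D z i c d i b) = ddric z d c b - ddric z c d b"
  "tr (\<lambda>i. D i z b i c d) = - (ddric z d c b - ddric z c d b + div_act z b c d)"
  "tr (\<lambda>i. D i z c d i b) = ddric z d c b - ddric z c d b + div_act z b c d"
  "tr (\<lambda>i. D a b i i c d) = 0"
  "tr (\<lambda>i. D a b i c i d) = - ddric a b c d"
  "tr (\<lambda>i. D a b c i i d) = ddric a b c d"
  "tr (\<lambda>i. D a b i c d i) = ddric a b c d"
proof -
  show "tr (\<lambda>i. D z i b i c d) = - (ddric z d c b - ddric z c d b)"
    unfolding divergence[symmetric] tr_minus[symmetric] by (intro arg_cong[where f=tr] ext D_skew12)
  show "tr (\<lambda>i. D z i c d i b) = ddric z d c b - ddric z c d b"
    unfolding divergence[symmetric] by (intro arg_cong[where f=tr] ext D_pair)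
  show "tr (\<lambda>i. D i z b i c d) = - (ddric z d c b - ddric z c d b + div_act z b c d)"
    unfolding divergence'[symmetric] tr_minus[symmetric] by (intro arg_cong[where f=tr] ext D_skew12)
  show "tr (\<lambda>i. D i z c d i b) = ddric z d c b - ddric z c d b + div_act z b c d"
    unfolding divergence'[symmetric] by (intro arg_cong[where f=tr] ext D_pair)
  have "D a b i i c d = 0" for i
    using D_skew12[of a b i i c d] by linarith
  then show "tr (\<lambda>i. D a b i i c d) = 0"
    by (simp add: tr_simps)
  show "tr (\<lambda>i. D a b i c i d) = - ddric a b c d"
    unfolding ddric_tr minus_minus by (intro arg_cong[where f=tr] ext D_flip)
  show "tr (\<lambda>i. D a b c i i d) = ddric a b c d"
    unfolding ddric_tr tr_minus[symmetric] by (intro arg_cong[where f=tr] ext D_skew34)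
  show "tr (\<lambda>i. D a b i c d i) = ddric a b c d"
    unfolding ddric_tr tr_minus[symmetric] by (intro arg_cong[where f=tr] ext D_skew12)
qed

lemma tr_Q:
  "tr (\<lambda>i. Q i i x y) = 0" "tr (\<lambda>i. Q i x i y) = 0" "tr (\<lambda>i. Q x i i y) = 0"
proof -
  have "Q i i x y = 0" for i
    using Q_skew12[of i i x y] by linarith
  then show "tr (\<lambda>i. Q i i x y) = 0"
    by (simp add: tr_simps)
  have "Q i x i y = - Q i x y i" for i
    using Q_pair[of i x i y] Q_skew12[of i y i x] Q_pair[of y i i x] by linarith
  then show "tr (\<lambda>i. Q i x i y) = 0"
    by (simp add: tr_simps ric_Q)
  have "Q x i i y = Q i y x i" for i
    by (rule Q_pair)
  then show "tr (\<lambda>i. Q x i i y) = 0"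
    by (simp add: ric_Q)
qed

lemma tr_Q_metric:
  "tr (\<lambda>i. Q i x y z * g i w) = Q w x y z" "tr (\<lambda>i. Q i x y z * g w i) = Q w x y z"
  "tr (\<lambda>i. Q x i y z * g i w) = Q x w y z" "tr (\<lambda>i. Q x i y z * g w i) = Q x w y z"
  "tr (\<lambda>i. Q x y i z * g i w) = Q x y w z" "tr (\<lambda>i. Q x y i z * g w i) = Q x y w z"
  using tr_metric[OF Q_linear(1), of w x y z] tr_metric[OF Q_linear(2), of w x y z]
    tr_metric[OF Q_linear(3), of w x y z]
  by (simp_all add: mult.commute[of "g _ _"] g_sym[of w])

lemmas trace_simps = obstruction_def perm_sum4_def perm_sum3_def tr_simps divergence divergence' tr_ddR tr_Q
  tr_Q_metric laplacian ric_Q tr_dimension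

text \<open>
  The contribution of \<open>R*R\<close> is its Ricci trace, which is zero.
\<close>
lemma obstruction_trace_xy:
  "24 * tr (\<lambda>i. obstruction a b c d i i) = perm_sum4 ddric a b c d"
  by (simp add: trace_simps)

text \<open>
  Commutators enter only as the symmetrization of \<open>div_act\<close> in its first three arguments, which vanishes.
  Contracting \<open>x\<close> with the metric gives \<open>Q(c, a, b, y)\<close>, skew in the symmetrized arguments \<open>a, c\<close>.
\<close>
lemma obstruction_trace_xi_x:
  "24 * tr (\<lambda>i. obstruction i a b c i y)
     = perm_sum3 (\<lambda>a b c. 2 * ddric a y b c - 3 * ddric a b c y) a b c"
  using div_act_perm_sum[of y a b c] Q_skew12[of a b c y] Q_skew12[of a c b y] Q_skew12[of b c a y]
  by (simp add: trace_simps ddric_sym12 ddric_sym34)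

text \<open>
  The product rule for the Laplacian in \<open>\<xi>\<close> of \<open>Q(x, \<xi>, \<xi>, y) g(\<xi>, \<xi>)\<close>: contracting within \<open>g\<close> gives
  \<open>n\<close>, the mixed contractions give \<open>4\<close>, and contracting within \<open>Q\<close> gives its Ricci trace, zero.
\<close>
lemma product_trace_xi_xi:
  "tr (\<lambda>i. perm_sum4 (\<lambda>a b c d. Q x a b y * g c d) i i c d)
     = (real n + 4) * (2 * Q x c d y + 2 * Q x d c y)"
  by (simp add: trace_simps tr_Q_metric[unfolded mult.commute[of _ "g _ _"]], simp add: algebra_simps)

lemma jet_trace_xi_xi:
  "tr (\<lambda>i. perm_sum4 (\<lambda>a b c d. D a b x c d y) i i c d)
     = 2 * (div_act x c d y - 2 * div_act c x d y + div_act c y x d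
          + div_act x d c y - 2 * div_act d x c y + div_act d y x c)
     + 24 * ddric c d x y + 4 * ddric x y c d
     - 6 * (ddric c x d y + ddric c y d x + ddric d x c y + ddric d y c x)"
  by (simp add: trace_simps ddric_sym12 ddric_sym34)

text \<open>
  After symmetrization in \<open>x, y\<close>, the commutators cancel against \<open>R*R\<close> by \<open>div_act_cubic\<close> and skewness
  alone. Nothing is lost, since \<open>obstruction\<close> is symmetric in these arguments.
\<close>
lemma obstruction_trace_xi_xi:
  "tr (\<lambda>i. obstruction i i c d x y) + tr (\<lambda>i. obstruction i i c d y x)
     = 2 * ddric c d x y + ddric x y c d / 3
     - (ddric c x d y + ddric c y d x + ddric d x c y + ddric d y c x) / 2"
proof -
  have *: "24 * tr (\<lambda>i. obstruction i i c d x y)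
    = tr (\<lambda>i. perm_sum4 (\<lambda>a b c d. D a b x c d y) i i c d) - (2 * Q x c d y + 2 * Q x d c y)" for x y
    by (simp add: obstruction_def tr_simps product_trace_xi_xi)
  \<comment> \<open>the combination of commutators left over by \<open>R*R\<close>; a consequence of the polarized \<open>div_act_cubic\<close>\<close>
  have "div_act c x d y + div_act d x c y + div_act c y d x + div_act d y c x
      = div_act y d x c + div_act y c x d + div_act x d y c + div_act x c y d"
    using div_act_perm_sum[of y x c d] div_act_perm_sum[of x y c d] div_act_skew[of c d x y] div_act_skew[of d c x y]
      div_act_skew[of x c d y] div_act_skew[of x d c y] div_act_skew[of y c d x] div_act_skew[of y d c x]
    unfolding perm_sum3_def by linarith
  then show ?thesis
    using *[of x y] *[of y x] ddric_sym34[of c d x y] ddric_sym12[of x y c d]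
    unfolding jet_trace_xi_xi Q_eq by (simp add: field_simps)
qed

section \<open>Trace-freeness and the second derivative of the Ricci tensor\<close>
lemma ddric_zero_if_traces_zero:
  assumes 12: "\<And>c d x y. tr (\<lambda>i. obstruction i i c d x y) = 0"
    and 15: "\<And>a b c y. tr (\<lambda>i. obstruction i a b c i y) = 0"
    and 56: "\<And>a b c d. tr (\<lambda>i. obstruction a b c d i i) = 0"
  shows "ddric a b x y = 0"
proof -
  \<comment> \<open>With \<open>a = P(z,z;x,y)\<close>, \<open>b = P(x,y;z,z)\<close>, \<open>c = P(z,x;z,y)\<close>, \<open>d = P(z,y;z,x)\<close>, the traces used here say
    \<open>a + b + 2(c + d) = 0\<close>, \<open>4b + 8d = 6a + 12c\<close>, \<open>4b + 8c = 6a + 12d\<close> and \<open>6a + b = 3(c + d)\<close>.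
    The first three give \<open>a = b\<close> and \<open>c = d = - a/2\<close>, and the last becomes \<open>10a = 0\<close>.\<close>
  have diag: "ddric z z x y = 0" for z
    using obstruction_trace_xi_xi[of z z x y] obstruction_trace_xi_x[of z z x y]
      obstruction_trace_xi_x[of z z y x] obstruction_trace_xy[of z z x y]
    by (simp add: 12 15 56 perm_sum3_def perm_sum4_def ddric_sym12 ddric_sym34)
  have add: "ddric (a + a') b x y = ddric a b x y + ddric a' b x y" for a a' b
    by (rule linear_add[OF ddric_linear])
  have "ddric (a + b) (a + b) x y = ddric a a x y + 2 * ddric a b x y + ddric b b x y"
    using add[of a b "a + b"] add[of a b a] add[of a b b] ddric_sym12[of a "a + b" x y]
      ddric_sym12[of b "a + b" x y] ddric_sym12[of b a x y] by linarith
  then show ?thesis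
    by (simp add: diag)
qed

lemma traces_zero_if_ddric_zero:
  assumes ddric: "\<And>a b x y. ddric a b x y = 0"
  shows "tr (\<lambda>i. obstruction i i c d x y) = 0"
    and "tr (\<lambda>i. obstruction i a b c i y) = 0"
    and "tr (\<lambda>i. obstruction a b c d i i) = 0"
proof -
  have "tr (\<lambda>i. obstruction i i c d y x) = tr (\<lambda>i. obstruction i i c d x y)"
    by (intro arg_cong[where f=tr] ext obstruction_swap_xy)
  then show "tr (\<lambda>i. obstruction i i c d x y) = 0"
    using obstruction_trace_xi_xi[of c d x y] by (simp add: ddric)
  show "tr (\<lambda>i. obstruction i a b c i y) = 0" "tr (\<lambda>i. obstruction a b c d i i) = 0"
    using obstruction_trace_xi_x[of a b c y] obstruction_trace_xy[of a b c d]
    by (simp_all add: ddric perm_sum3_def perm_sum4_def)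
qed

lemma totally_trace_free_iff:
  "totally_trace_free g n e 6
      (\<lambda>v. jacobi2 D v (v 5) (v 6) - 1 / (real n + 4) * sym_prod (jacobi Q) g v (v 5) (v 6))
    \<longleftrightarrow> (\<forall>a b x y. ddric a b x y = 0)"
  (is "?free \<longleftrightarrow> _")
proof
  assume ?free
  note traces = this[unfolded totally_trace_free_def obstruction_eq, rule_format]
  have free: "tr (\<lambda>i. obstruction ((v(p := i, q := i)) 1) ((v(p := i, q := i)) 2)
      ((v(p := i, q := i)) 3) ((v(p := i, q := i)) 4) ((v(p := i, q := i)) 5) ((v(p := i, q := i)) 6)) = 0"
    if "p \<in> {1..6}" "q \<in> {1..6}" "p \<noteq> q" for p q :: nat and v
    unfolding tr_def by (rule traces[OF that])
  show "\<forall>a b x y. ddric a b x y = 0"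
  proof (intro allI ddric_zero_if_traces_zero)
    fix a b c d x y
    let ?v = "\<lambda>a b c d x y. (\<lambda>_. 0)(1 := a, 2 := b, 3 := c, 4 := d, 5 := x, 6 := y)"
    show "tr (\<lambda>i. obstruction i i c d x y) = 0"
      using free[of 1 2 "?v 0 0 c d x y"] by simp
    show "tr (\<lambda>i. obstruction i a b c i y) = 0"
      using free[of 1 5 "?v 0 a b c 0 y"] by simp
    show "tr (\<lambda>i. obstruction a b c d i i) = 0"
      using free[of 5 6 "?v a b c d 0 0"] by simp
  qed
next
  assume "\<forall>a b x y. ddric a b x y = 0"
  then have ddric: "\<And>a b x y. ddric a b x y = 0" by blast
  note zero = traces_zero_if_ddric_zero[OF ddric]
  \<comment> \<open>All other pairs of slots reduce to \<open>(1,2)\<close>, \<open>(1,5)\<close> and \<open>(5,6)\<close> by the symmetries of \<open>obstruction\<close>.\<close>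
  have 12: "tr (\<lambda>i. obstruction i i c d x y) = 0" for c d x y
    by (rule zero(1))
  have 13: "tr (\<lambda>i. obstruction i c i d x y) = 0" for c d x y
    unfolding obstruction_swap(2)[of _ c _ d] by (rule 12)
  have 14: "tr (\<lambda>i. obstruction i c d i x y) = 0" for c d x y
    unfolding obstruction_swap(3)[of _ c d] by (rule 13)
  have 23: "tr (\<lambda>i. obstruction c i i d x y) = 0" for c d x y
    unfolding obstruction_swap(1)[of c] by (rule 13)
  have 24: "tr (\<lambda>i. obstruction c i d i x y) = 0" for c d x y
    unfolding obstruction_swap(1)[of c] by (rule 14)
  have 34: "tr (\<lambda>i. obstruction c d i i x y) = 0" for c d x y
    unfolding obstruction_swap(2)[of c d] by (rule 24)
  have 15: "tr (\<lambda>i. obstruction i a b c i y) = 0" for a b c y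
    by (rule zero(2))
  have 25: "tr (\<lambda>i. obstruction a i b c i y) = 0" for a b c y
    unfolding obstruction_swap(1)[of a] by (rule 15)
  have 35: "tr (\<lambda>i. obstruction a b i c i y) = 0" for a b c y
    unfolding obstruction_swap(2)[of a b] by (rule 25)
  have 45: "tr (\<lambda>i. obstruction a b c i i y) = 0" for a b c y
    unfolding obstruction_swap(3)[of a b c] by (rule 35)
  have 6: "tr (\<lambda>i. obstruction i a b c y i) = 0" "tr (\<lambda>i. obstruction a i b c y i) = 0"
      "tr (\<lambda>i. obstruction a b i c y i) = 0" "tr (\<lambda>i. obstruction a b c i y i) = 0" for a b c y
    unfolding obstruction_swap_xy[of _ _ _ _ y] by (rule 15 25 35 45)+
  have slots: "{1..6} = {1, 2, 3, 4, 5, 6::nat}" by auto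
  have "tr (\<lambda>i. obstruction ((v(p := i, q := i)) 1) ((v(p := i, q := i)) 2)
      ((v(p := i, q := i)) 3) ((v(p := i, q := i)) 4) ((v(p := i, q := i)) 5) ((v(p := i, q := i)) 6)) = 0"
    if "p \<in> {1..6}" "q \<in> {1..6}" "p \<noteq> q" for p q :: nat and v
    using that unfolding slots by (auto simp: 12 13 14 23 24 34 15 25 35 45 6 zero(3))
  then show ?free
    unfolding totally_trace_free_def obstruction_eq tr_def by (intro ballI impI allI)
qed

end

theorem theorem1:
  fixes g :: "'v::real_vector \<Rightarrow> 'v \<Rightarrow> real"
    and n :: nat
    and e :: "nat \<Rightarrow> 'v"
    and R :: "'v \<Rightarrow> 'v \<Rightarrow> 'v \<Rightarrow> 'v \<Rightarrow> real"
    and dR :: "'v \<Rightarrow> 'v \<Rightarrow> 'v \<Rightarrow> 'v \<Rightarrow> 'v \<Rightarrow> real"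
    and ddR :: "'v \<Rightarrow> 'v \<Rightarrow> 'v \<Rightarrow> 'v \<Rightarrow> 'v \<Rightarrow> 'v \<Rightarrow> real"
  assumes "pseudo_euclidean g"
    and "orthonormal_basis g n e"
    and "two_jet g R dR ddR"
  shows "einstein_two_jet g n e R dR ddR \<longleftrightarrow>
    (\<exists>c. \<forall>x y. ric g n e R x y = c * g x y) \<and>
    (\<forall>z x y. ric g n e (dR z) x y = 0) \<and>
    totally_trace_free g n e 6
      (\<lambda>v. jacobi2 ddR v (v 5) (v 6)
         - 1 / (real n + 4) * sym_prod (jacobi (curv_star g n e R)) g v (v 5) (v 6))"
proof (cases "\<exists>\<kappa>. \<forall>x y. ric g n e R x y = \<kappa> * g x y")
  case True
  then obtain \<kappa> where "\<forall>x y. ric g n e R x y = \<kappa> * g x y" ..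
  moreover have "R \<in> \<C>\<^sub>0"
    using assms(3) by (simp only: two_jet_def)
  ultimately interpret einstein_two_jet_frame g n e R \<kappa> dR ddR
    using assms by unfold_locales blast+
  show ?thesis
    using totally_trace_free_iff by (auto simp: einstein_two_jet_def ddric_def)
next
  \<comment> \<open>both sides fail\<close>
  case False
  then show ?thesis
    by (simp only: einstein_two_jet_def simp_thms)
qed

end
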